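(* Let $\Lambda$ be a topological group and let $\Gamma\subset\Lambda$ be a dense subgroup (with the induced topology). Any continuous homogeneous quasi-morphism on $\Gamma$ extends to a continuous homogeneous quasi-morphism on $\Lambda$.
   Context: A homogeneous quasi-morphism on a group $G$ is a map $\mu:G\to\mathbb{R}$ such that (i) there is a constant $C(\mu)\ge 0$ with $|\mu(xy)-\mu(x)-\mu(y)|\le C(\mu)$ for all $x,y\in G$, and (ii) $\mu(x^n)=n\mu(x)$ for all $x\in G$, $n\in\mathbb{Z}$. *)

theory Defs
  imports "HOL-Algebra.Algebra" "HOL-Analysis.Product_Topology"
begin

text \<open>The topology need not be Hausdorff.\<close>

locale topological_group = group G for G (structure) +
  fixes T :: "'a topology"
  assumes topspace_eq_carrier: "topspace T = carrier G"
    and continuous_mult: "continuous_map (prod_topology T T) T (\<lambda>(x, y). x \<otimes> y)"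
    and continuous_inv: "continuous_map T T (\<lambda>x. inv x)"

definition homogeneous_quasimorphism :: "('a, 'b) monoid_scheme \<Rightarrow> ('a \<Rightarrow> real) \<Rightarrow> bool" where
  "homogeneous_quasimorphism G \<mu> \<longleftrightarrow>
     (\<exists>C\<ge>0. \<forall>x\<in>carrier G. \<forall>y\<in>carrier G. \<bar>\<mu> (x \<otimes>\<^bsub>G\<^esub> y) - \<mu> x - \<mu> y\<bar> \<le> C) \<and>
     (\<forall>x\<in>carrier G. \<forall>n::int. \<mu> (x [^]\<^bsub>G\<^esub> n) = of_int n * \<mu> x)"

end

theory Submission
  imports Defs "HOL-Analysis.Urysohn"
begin

text \<open>
  The point is that \<open>\<mu>\<close> already satisfies a Cauchy condition at every point \<open>x\<close> of the ambient
  group, although \<open>\<mu>\<close> need not be uniformly continuous and \<open>x\<close> need not lie in the dense subgroup.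
  By continuity at \<open>\<one>\<close> there is an open neighbourhood \<open>U\<close> of \<open>\<one>\<close> with \<open>\<bar>\<mu>\<bar> < 1\<close> on \<open>\<Gamma> \<inter> U\<close>.
  Fix \<open>n \<ge> 1\<close>. If \<open>y\<close> and \<open>z\<close> are close enough to \<open>x\<close>, then \<open>y\<^sup>n\<close> and \<open>z\<^sup>n\<close> differ by an element
  of \<open>U\<close>, so \<open>\<mu>(y\<^sup>n)\<close> and \<open>\<mu>(z\<^sup>n)\<close> differ by less than \<open>C + 1\<close>, where \<open>C\<close> bounds the defect of
  \<open>\<mu>\<close>. Homogeneity turns this into \<open>\<bar>\<mu>(y) - \<mu>(z)\<bar> < (C + 1) / n\<close>; as \<open>n\<close> grows, the
  oscillation of \<open>\<mu>\<close> at \<open>x\<close> is seen to be \<open>0\<close> (lemma \<open>small_oscillation\<close>).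

  Since the real line is complete and regular, \<open>\<mu>\<close> has a continuous extension \<open>\<nu>\<close>
  (lemma \<open>continuous_extension_of_zero_oscillation\<close>). Finally \<open>\<nu>\<close> inherits the
  defect bound and homogeneity from \<open>\<mu>\<close> because both are closed conditions
  (lemma \<open>homogeneous_quasimorphism_of_dense\<close>).
\<close>

lemma continuous_extension_of_zero_oscillation:
  fixes Z :: "'a topology" and f :: "'a \<Rightarrow> 'b::complete_space"
  assumes "continuous_map (subtopology Z S) euclidean f"
    and dense: "Z closure_of S = topspace Z" and "S \<subseteq> topspace Z"
    and osc: "\<And>x \<epsilon>. \<lbrakk>x \<in> topspace Z; \<epsilon> > 0\<rbrakk> \<Longrightarrow>
      \<exists>U. openin Z U \<and> x \<in> U \<and> (\<forall>y\<in>S \<inter> U. \<forall>z\<in>S \<inter> U. dist (f y) (f z) < \<epsilon>)"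
  obtains g where "continuous_map Z euclidean g" "\<And>x. x \<in> S \<Longrightarrow> g x = f x"
proof -
  have lim: "\<exists>l. limitin euclidean f l (atin_within Z x S)" if "x \<in> topspace Z" for x
  proof -
    have "\<exists>U. openin Z U \<and> x \<in> U \<and>
            (\<forall>y \<in> (S \<inter> U) - {x}. \<forall>z \<in> (S \<inter> U) - {x}. dist (f y) (f z) < \<epsilon>)"
      if "\<epsilon> > 0" for \<epsilon>
      using osc [OF \<open>x \<in> topspace Z\<close> that] by blast
    moreover have "Met_TC.mcomplete TYPE('b)"
      by (simp add: mcomplete_iff_complete complete_UNIV)
    ultimately show ?thesis
      using Met_TC.convergent_eq_zero_oscillation_gen [of f Z S x] by simp
  qed
  obtain g where "continuous_map (subtopology Z (topspace Z)) euclidean g"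
      "\<And>x. x \<in> S \<Longrightarrow> g x = f x"
  proof (rule continuous_map_extension_pointwise_alt [of euclidean S "topspace Z" Z f])
    show "regular_space (euclidean :: 'b topology)"
      using metrizable_imp_regular_space metrizable_space_euclidean by blast
  qed (use assms lim in auto)
  then show thesis
    using that by simp
qed

context topological_group
begin

lemma continuous_map_mult:
  assumes "continuous_map Z T f" "continuous_map Z T g"
  shows "continuous_map Z T (\<lambda>p. f p \<otimes> g p)"
  using continuous_map_compose [OF continuous_map_pairedI [OF assms] continuous_mult]
  by (simp add: o_def)

lemma continuous_map_nat_pow:
  assumes "continuous_map Z T f"
  shows "continuous_map Z T (\<lambda>p. f p [^] (n::nat))"
proof (induction n)
  case 0
  then show ?case
    by (simp add: topspace_eq_carrier)
next
  case (Suc n)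
  then show ?case
    using continuous_map_mult [OF Suc assms] by simp
qed

lemma continuous_map_minv:
  assumes "continuous_map Z T f"
  shows "continuous_map Z T (\<lambda>p. inv (f p))"
  using continuous_map_compose [OF assms continuous_inv] by (simp add: o_def)

lemma continuous_map_int_pow:
  assumes "continuous_map Z T f"
  shows "continuous_map Z T (\<lambda>p. f p [^] (n::int))"
proof (cases "n < 0")
  case True
  then show ?thesis
    using continuous_map_minv [OF continuous_map_nat_pow [OF assms]]
    by (simp only: int_pow_def2 if_True)
next
  case False
  then show ?thesis
    using continuous_map_nat_pow [OF assms]
    by (simp only: int_pow_def2 if_False)
qed

text \<open>The map \<open>(y, z) \<mapsto> (y\<^sup>n)\<^sup>-\<^sup>1 z\<^sup>n\<close> is continuous and takes the value \<open>\<one>\<close> on the diagonal.\<close>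

lemma powers_differ_in_neighbourhood:
  fixes n :: nat
  assumes "openin T U" "\<one> \<in> U" "x \<in> carrier G"
  obtains N where "openin T N" "x \<in> N"
    "\<And>y z. \<lbrakk>y \<in> N; z \<in> N\<rbrakk> \<Longrightarrow> inv (y [^] n) \<otimes> z [^] n \<in> U"
proof -
  define q where "q = (\<lambda>p. inv (fst p [^] n) \<otimes> snd p [^] n)"
  define W where "W = {p \<in> topspace (prod_topology T T). q p \<in> U}"
  have "continuous_map (prod_topology T T) T q"
    unfolding q_def
    by (intro continuous_map_mult continuous_map_minv continuous_map_nat_pow
        continuous_map_fst continuous_map_snd)
  then have "openin (prod_topology T T) W"
    unfolding W_def using assms(1) by (rule openin_continuous_map_preimage)
  moreover have "(x, x) \<in> W"
    using assms by (simp add: W_def q_def topspace_eq_carrier)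
  ultimately obtain A B where "openin T A" "openin T B" "x \<in> A" "x \<in> B" "A \<times> B \<subseteq> W"
    unfolding openin_prod_topology_alt by meson
  then show thesis
    by (intro that [of "A \<inter> B"]) (auto simp: W_def q_def)
qed

text \<open>
  The base point \<open>x\<close> ranges over the whole group, and only \<open>y\<close> and \<open>z\<close> are restricted to the
  subgroup: this is the Cauchy condition that an extension beyond \<open>\<Gamma>\<close> requires. Homogeneity
  improves a bound on \<open>\<mu>\<close> near \<open>\<one>\<close> to an arbitrarily small oscillation near every point.
\<close>

lemma small_oscillation:
  assumes \<Gamma>: "subgroup \<Gamma> G"
    and \<mu>: "homogeneous_quasimorphism (G\<lparr>carrier := \<Gamma>\<rparr>) \<mu>"
    and cont: "continuous_map (subtopology T \<Gamma>) euclideanreal \<mu>"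
    and x: "x \<in> carrier G" and \<epsilon>: "\<epsilon> > 0"
  shows "\<exists>N. openin T N \<and> x \<in> N \<and> (\<forall>y\<in>\<Gamma> \<inter> N. \<forall>z\<in>\<Gamma> \<inter> N. dist (\<mu> y) (\<mu> z) < \<epsilon>)"
proof -
  interpret \<Gamma>: subgroup \<Gamma> G by (fact \<Gamma>)
  obtain C where "C \<ge> 0"
      and C: "\<And>x y. \<lbrakk>x \<in> \<Gamma>; y \<in> \<Gamma>\<rbrakk> \<Longrightarrow> \<bar>\<mu> (x \<otimes> y) - \<mu> x - \<mu> y\<bar> \<le> C"
    using \<mu> by (auto simp: homogeneous_quasimorphism_def)
  have hom: "\<mu> (y [^] (k::int)) = of_int k * \<mu> y" if "y \<in> \<Gamma>" for y k
    using \<mu> that int_pow_consistent [OF \<Gamma> that]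
    by (simp add: homogeneous_quasimorphism_def)
  have hom_nat: "\<mu> (y [^] (k::nat)) = real k * \<mu> y" if "y \<in> \<Gamma>" for y k
    using hom [OF that, of "int k"] by (simp add: int_pow_int)
  have pow_mem: "y [^] (k::nat) \<in> \<Gamma>" if "y \<in> \<Gamma>" for y k
    by (induction k) (use that in auto)
  have "\<mu> \<one> = 0"
    using hom_nat [of \<one> 0] by simp
  have "openin (subtopology T \<Gamma>) {w \<in> topspace (subtopology T \<Gamma>). \<mu> w \<in> {-1<..<1}}"
    using cont by (rule openin_continuous_map_preimage) simp
  then obtain U where U: "openin T U"
      "{w \<in> topspace (subtopology T \<Gamma>). \<mu> w \<in> {-1<..<1}} = U \<inter> \<Gamma>"
    by (auto simp: openin_subtopology)
  have "\<one> \<in> U \<inter> \<Gamma>"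
    unfolding U(2) [symmetric] using \<open>\<mu> \<one> = 0\<close> by (simp add: topspace_eq_carrier)
  have bounded: "\<bar>\<mu> w\<bar> < 1" if "w \<in> U" "w \<in> \<Gamma>" for w
    using that U(2) by (auto simp: set_eq_iff abs_less_iff)
  \<comment> \<open>Powers close to \<open>x\<^sup>n\<close> have values at distance less than \<open>C + 1\<close>, and by homogeneity
    the values at the elements themselves are closer by the factor \<open>n\<close>.\<close>
  obtain n where n: "(C + 1) / \<epsilon> < real n"
    using reals_Archimedean2 by blast
  moreover have "0 < (C + 1) / \<epsilon>"
    using \<open>C \<ge> 0\<close> \<epsilon> by simp
  ultimately have "n > 0"
    by (metis of_nat_0_less_iff order.strict_trans)
  obtain N where N: "openin T N" "x \<in> N"
      "\<And>y z. \<lbrakk>y \<in> N; z \<in> N\<rbrakk> \<Longrightarrow> inv (y [^] n) \<otimes> z [^] n \<in> U"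
    using powers_differ_in_neighbourhood [of U x n] U(1) \<open>\<one> \<in> U \<inter> \<Gamma>\<close> x by blast
  have "dist (\<mu> y) (\<mu> z) < \<epsilon>" if y: "y \<in> \<Gamma> \<inter> N" and z: "z \<in> \<Gamma> \<inter> N" for y z
  proof -
    define w where "w = inv (y [^] n) \<otimes> z [^] n"
    have mem: "y [^] n \<in> \<Gamma>" "z [^] n \<in> \<Gamma>"
      using y z pow_mem by auto
    then have "w \<in> \<Gamma>"
      by (simp add: w_def)
    moreover have "w \<in> U"
      using N(3) y z by (simp add: w_def)
    ultimately have "\<bar>\<mu> w\<bar> < 1"
      by (rule bounded [rotated])
    moreover have "y [^] n \<otimes> w = z [^] n"
      unfolding w_def using mem \<Gamma>.subset
      by (metis inv_solve_left \<Gamma>.mem_carrier inv_closed m_closed)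
    with C [OF mem(1) \<open>w \<in> \<Gamma>\<close>]
    have "\<bar>real n * \<mu> z - real n * \<mu> y - \<mu> w\<bar> \<le> C"
      using y z hom_nat by simp
    ultimately have "\<bar>real n * \<mu> z - real n * \<mu> y\<bar> < C + 1"
      by linarith
    also have "\<dots> < real n * \<epsilon>"
      using n \<epsilon> by (simp add: field_simps)
    finally have "real n * \<bar>\<mu> z - \<mu> y\<bar> < real n * \<epsilon>"
      by (simp add: abs_mult flip: right_diff_distrib)
    then show ?thesis
      using \<open>n > 0\<close> by (simp add: dist_real_def abs_minus_commute)
  qed
  with N(1,2) show ?thesis
    by blast
qed

text \<open>
  A continuous \<open>\<nu>\<close> satisfies \<open>\<bar>\<nu>(xy) - \<nu>(x) - \<nu>(y)\<bar> \<le> C\<close> on a closed set of pairs, which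
  contains the closure of \<open>\<Gamma> \<times> \<Gamma>\<close>; the same \<open>C\<close> therefore serves for the whole group. For
  each \<open>n\<close>, the equation \<open>\<nu>(x\<^sup>n) = n \<nu>(x)\<close> equates two continuous real functions of \<open>x\<close>, so it
  too extends from \<open>\<Gamma>\<close> to its closure.
\<close>

lemma homogeneous_quasimorphism_of_dense:
  assumes \<Gamma>: "subgroup \<Gamma> G" and dense: "T closure_of \<Gamma> = topspace T"
    and \<nu>: "homogeneous_quasimorphism (G\<lparr>carrier := \<Gamma>\<rparr>) \<nu>"
    and cont: "continuous_map T euclideanreal \<nu>"
  shows "homogeneous_quasimorphism G \<nu>"
proof -
  obtain C where "C \<ge> 0"
      and C: "\<And>x y. \<lbrakk>x \<in> \<Gamma>; y \<in> \<Gamma>\<rbrakk> \<Longrightarrow> \<bar>\<nu> (x \<otimes> y) - \<nu> x - \<nu> y\<bar> \<le> C"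
    using \<nu> by (auto simp: homogeneous_quasimorphism_def)
  note comp = continuous_map_compose [OF _ cont, unfolded o_def]
  have "\<bar>\<nu> (x \<otimes> y) - \<nu> x - \<nu> y\<bar> \<le> C" if "x \<in> carrier G" "y \<in> carrier G" for x y
  proof -
    let ?d = "\<lambda>p. \<bar>\<nu> (fst p \<otimes> snd p) - \<nu> (fst p) - \<nu> (snd p)\<bar>"
    have "continuous_map (prod_topology T T) euclideanreal ?d"
      by (intro continuous_map_real_abs continuous_map_diff comp continuous_map_mult
          continuous_map_fst continuous_map_snd)
    then have "closedin (prod_topology T T) {p \<in> topspace (prod_topology T T). ?d p \<in> {..C}}"
      by (rule closedin_continuous_map_preimage) simp
    then have closed: "closedin (prod_topology T T)
        {p \<in> topspace (prod_topology T T). ?d p \<le> C}"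
      by (simp only: atMost_iff)
    have "(x, y) \<in> (prod_topology T T) closure_of (\<Gamma> \<times> \<Gamma>)"
      using that dense by (simp add: closure_of_Times topspace_eq_carrier)
    then have "?d (x, y) \<le> C"
    proof (rule forall_in_closure_of [OF _ _ closed])
      show "?d p \<le> C" if "p \<in> \<Gamma> \<times> \<Gamma>" for p
        using C that by (cases p) simp
    qed
    then show ?thesis
      by simp
  qed
  moreover have "\<nu> (x [^] (n::int)) = of_int n * \<nu> x" if "x \<in> carrier G" for x n
  proof (rule forall_in_closure_of_eq [where X = T and Y = euclideanreal and S = \<Gamma>])
    show "x \<in> T closure_of \<Gamma>"
      using that dense by (simp add: topspace_eq_carrier)
    show "continuous_map T euclideanreal (\<lambda>x. \<nu> (x [^] n))"
      by (intro comp continuous_map_int_pow) simp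
    show "continuous_map T euclideanreal (\<lambda>x. of_int n * \<nu> x)"
      by (intro continuous_map_real_mult cont) simp
    show "\<nu> (y [^] n) = of_int n * \<nu> y" if "y \<in> \<Gamma>" for y
      using \<nu> that int_pow_consistent [OF \<Gamma> that]
      by (simp add: homogeneous_quasimorphism_def)
  qed simp
  ultimately show ?thesis
    using \<open>C \<ge> 0\<close> by (auto simp: homogeneous_quasimorphism_def)
qed

end

lemma homogeneous_quasimorphism_cong:
  assumes "group G" "\<And>x. x \<in> carrier G \<Longrightarrow> \<mu> x = \<nu> x"
  shows "homogeneous_quasimorphism G \<mu> \<longleftrightarrow> homogeneous_quasimorphism G \<nu>"
proof -
  interpret group G by (fact assms(1))
  show ?thesis
    by (simp add: homogeneous_quasimorphism_def assms(2) cong: ball_cong)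
qed

theorem proposition1p4:
  fixes \<Lambda> :: "('a, 'b) monoid_scheme" and T :: "'a topology"
    and \<Gamma> :: "'a set" and \<mu> :: "'a \<Rightarrow> real"
  assumes "topological_group \<Lambda> T"
    and "subgroup \<Gamma> \<Lambda>"
    and "T closure_of \<Gamma> = topspace T"
    and "homogeneous_quasimorphism (\<Lambda>\<lparr>carrier := \<Gamma>\<rparr>) \<mu>"
    and "continuous_map (subtopology T \<Gamma>) euclideanreal \<mu>"
  shows "\<exists>\<nu>. homogeneous_quasimorphism \<Lambda> \<nu> \<and> continuous_map T euclideanreal \<nu> \<and>
              (\<forall>x\<in>\<Gamma>. \<nu> x = \<mu> x)"
proof -
  interpret topological_group \<Lambda> T by (fact assms(1))
  have "\<Gamma> \<subseteq> topspace T"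
    using subgroup.subset [OF assms(2)] by (simp add: topspace_eq_carrier)
  moreover have "\<exists>N. openin T N \<and> x \<in> N \<and>
      (\<forall>y\<in>\<Gamma> \<inter> N. \<forall>z\<in>\<Gamma> \<inter> N. dist (\<mu> y) (\<mu> z) < \<epsilon>)"
    if "x \<in> topspace T" "\<epsilon> > 0" for x \<epsilon>
    using small_oscillation [OF assms(2,4,5)] that by (simp add: topspace_eq_carrier)
  ultimately obtain \<nu> where \<nu>: "continuous_map T euclideanreal \<nu>" "\<And>x. x \<in> \<Gamma> \<Longrightarrow> \<nu> x = \<mu> x"
    by (rule continuous_extension_of_zero_oscillation [OF assms(5,3)])
      (assumption, assumption, erule that, simp)
  have "homogeneous_quasimorphism (\<Lambda>\<lparr>carrier := \<Gamma>\<rparr>) \<nu>"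
    using assms(4) \<nu>(2) subgroup_imp_group [OF assms(2)]
    by (subst homogeneous_quasimorphism_cong [where \<nu> = \<mu>]) auto
  then have "homogeneous_quasimorphism \<Lambda> \<nu>"
    using homogeneous_quasimorphism_of_dense assms(2,3) \<nu>(1) by blast
  with \<nu> show ?thesis
    by blast
qed

end
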